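(* Let $\{x_k\}_{k\ge 0}$ be a sequence generated by the linearized $\ell_q$ penalty (qLP) algorithm (described in the context) with penalty parameter $\rho$, and suppose that $\{x_k\}_{k\ge0}\subseteq\mathcal S$ for some compact set $\mathcal S\subset\mathbb R^n$ on which Assumptions 1, 2 and 3 (stated in the context) hold. Let $\rho\ge\max\{1,(q+1)\rho_0\}$ and let $x_0$ satisfy $\|F(x_0)\|_q^q\le\min\{1,\,qc_0/\rho\}$. Let $0<\epsilon\le1$ and let $x_k$ be an iterate satisfying $\Psi_\epsilon(x_k)\le\epsilon^2$. Then there exists $\lambda_k\in\mathbb R^m$ such that $$\|\nabla f(x_k)+J_F(x_k)^T\lambda_k\|\le\epsilon.$$ Moreover, if $\rho$ is of order $1/\epsilon^{q-1}$, then $x_k$ is an $\epsilon$-first-order solution of $\min_x f(x)$ s.t. $F(x)=0$, and such an iterate is obtained within $k=\mathcal O\big(1/\epsilon^{2+\frac{q-1}q}\big)$ iterations. Precisely: for all $0<c_1\le c_2$ there are constants $\kappa,C>0$, independent of $\rho$ and $\epsilon$, such that if in addition $c_1/\epsilon^{q-1}\le\rho\le c_2/\epsilon^{q-1}$, then $\Psi_\epsilon(x_k)\le\epsilon^2$ implies that there is $\lambda_k$ with $\|\nabla f(x_k)+J_F(x_k)^T\lambda_k\|\le\epsilon$ and $\|F(x_k)\|\le\kappa\epsilon$, and there is an index $k\le C\,\epsilon^{-(2+\frac{q-1}q)}$ with $\Psi_\epsilon(x_k)\le\epsilon^2$.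
   Context: Problem: $\min_{x\in\mathbb R^n} f(x)$ s.t. $F(x)=0$, where $f:\mathbb R^n\to\mathbb R$ and $F=(f_1,\dots,f_m)^T:\mathbb R^n\to\mathbb R^m$ are $C^1$; the feasible set is nonempty and the optimal value is finite. $J_F(x)\in\mathbb R^{m\times n}$ is the Jacobian. $q\in(1,2]$ is fixed. $\|\cdot\|$ is the Euclidean norm of vectors or spectral norm of matrices; $\|\cdot\|_q$ is the vector $q$-norm. Assumption 1: for every $\alpha\in\mathbb R$ the set $\{x: f(x)\le\alpha\}$ is empty or compact. Assumption 2 on a compact set $\mathcal S$: there are positive constants $M_f,M_F,L_f,L_F$ such that for all $x,y\in\mathcal S$: $\|\nabla f(x)\|\le M_f$, $\|\nabla f(x)-\nabla f(y)\|\le L_f\|x-y\|$, $\|J_F(x)\|\le M_F$, $\|J_F(x)-J_F(y)\|\le L_F\|x-y\|$; and LICQ holds at all $x\in\mathcal S$ (the rows of $J_F(x)$ are linearly independent). Assumption 3: there is a finite $\bar\alpha$ with $f(x)\le\bar\alpha$ for all $x$ with $\|F(x)\|\le1$. Penalty function ($\rho>0$): $\mathcal P^q_\rho(x)=f(x)+\frac\rho q\|F(x)\|_q^q$. Its linearization: $\bar{\mathcal P}^q_\rho(x;\bar x)=f(\bar x)+\langle\nabla f(\bar x),x-\bar x\rangle+\frac\rho q\|F(\bar x)+J_F(\bar x)(x-\bar x)\|_q^q$. Criticality measure, for $0<r\le1$: $\Psi_r(x)=\mathcal P^q_\rho(x)-\min_{\|y-x\|\le r}\bar{\mathcal P}^q_\rho(y;x)$;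 $\Psi_\epsilon$ is $\Psi_r$ with $r=\epsilon$. qLP algorithm: given $x_0$, $\rho>0$, $\underline\beta\ge1$, for $k=0,1,2,\dots$ choose $\beta_{k+1}\ge\underline\beta$ such that $x_{k+1}=\arg\min_{x\in\mathbb R^n}\{\bar{\mathcal P}^q_\rho(x;x_k)+\frac{\beta_{k+1}}2\|x-x_k\|^2\}$ satisfies $$\mathcal P^q_\rho(x_{k+1})\le\bar{\mathcal P}^q_\rho(x_{k+1};x_k)+\tfrac{\beta_{k+1}}2\|x_{k+1}-x_k\|^2.$$ Constants: $c_0>0$ and $\rho_0>0$ are fixed, $\bar f=\inf_x f(x)$ (finite under Assumption 1), $\bar P=\bar\alpha+c_0$. It is assumed throughout that the parameters $\beta_k$ are generated (e.g. by backtracking with a fixed geometric factor $\mu>1$) so that $$\bar\beta:=\sup_{k\ge1}\beta_k\le\mu\Big(L_f+\big(3\,m^{\frac{(2-q)(q-1)}{2q}}2^{2-q}\big)^{\frac1q}q^{\frac{q-1}q}\rho^{\frac1q}L_F(\bar P-\bar f)^{\frac{q-1}q}\Big).$$ A point $\hat x$ is an $\epsilon$-first-order solution of the problem if there exist $\hat\lambda\in\mathbb R^m$ and $\kappa_1,\kappa_2>0$ with $\|\nabla f(\hat x)+J_F(\hat x)^T\hat\lambda\|\le\kappa_1\epsilon$ and $\|F(\hat x)\|\le\kappa_2\epsilon$. Convention on $\mathcal O$: the problem data $f,F,q,m,n$, the set $\mathcal S$, and the constants $M_f,M_F,L_f,L_F,\bar\alpha,c_0,\rho_0,\mu$ are regarded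 as fixed; implied constants do not depend on $\rho$ or $\epsilon$. *)

theory Defs
  imports "HOL-Analysis.Analysis"
begin

section \<open>Derivatives, norms and constraint qualification\<close>

definition C1 :: "('a::real_normed_vector \<Rightarrow> 'b::real_normed_vector) \<Rightarrow> bool" where
  "C1 g \<longleftrightarrow>
    (\<exists>g'. (\<forall>x. (g has_derivative blinfun_apply (g' x)) (at x)) \<and> continuous_on UNIV g')"

definition grad :: "(real^'n \<Rightarrow> real) \<Rightarrow> real^'n \<Rightarrow> real^'n" where
  "grad f x = (THE D. GDERIV f x :> D)"

lemma C1_GDERIV_grad:
  assumes "C1 f"
  shows "GDERIV f x :> grad f x"
proof -
  obtain f' where f': "(f has_derivative blinfun_apply (f' x)) (at x)"
    using assms by (auto simp: C1_def)
  let ?D = "adjoint (blinfun_apply (f' x)) 1"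
  have "h \<bullet> ?D = f' x h" for h
    using adjoint_works[OF bounded_linear.linear[OF blinfun.bounded_linear_right], of h "f' x" 1]
    by simp
  with f' have "GDERIV f x :> ?D"
    by (simp add: gderiv_def)
  moreover have "E = ?D" if "GDERIV f x :> E" for E
  proof -
    have "(\<lambda>h. h \<bullet> E) = (\<lambda>h. h \<bullet> ?D)"
      using that \<open>GDERIV f x :> ?D\<close> has_derivative_unique unfolding gderiv_def by blast
    then show ?thesis
      by (metis vector_eq_ldot)
  qed
  ultimately show ?thesis
    unfolding grad_def by (rule theI)
qed

abbreviation Jac :: "(real^'n \<Rightarrow> real^'m) \<Rightarrow> real^'n \<Rightarrow> real^'n^'m" where
  "Jac F x \<equiv> jacobian F (at x)"

text \<open>The library's norm on \<^typ>\<open>real^'n^'m\<close> is the Frobenius norm, not the spectral norm.\<close>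

definition spectral_norm :: "real^'n^'m \<Rightarrow> real" where
  "spectral_norm A = onorm (\<lambda>v. A *v v)"

definition qnorm :: "real \<Rightarrow> real^'m \<Rightarrow> real" where
  "qnorm q v = (\<Sum>i\<in>UNIV. \<bar>v $ i\<bar> powr q) powr (1 / q)"

lemma qnorm_powr:
  assumes "q > 0"
  shows "qnorm q v powr q = (\<Sum>i\<in>UNIV. \<bar>v $ i\<bar> powr q)"
proof -
  have "0 \<le> (\<Sum>i\<in>UNIV. \<bar>v $ i\<bar> powr q)"
    by (intro sum_nonneg) auto
  with assms show ?thesis
    by (simp add: qnorm_def powr_powr)
qed

text \<open>Linear independence of the family of rows. \<open>independent (rows A)\<close> would be too weak,
  since it ignores repeated rows.\<close>

definition rows_independent :: "real^'n^'m \<Rightarrow> bool" where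
  "rows_independent A \<longleftrightarrow>
    (\<forall>c :: 'm \<Rightarrow> real. (\<Sum>i\<in>UNIV. c i *\<^sub>R row i A) = 0 \<longrightarrow> (\<forall>i. c i = 0))"


section \<open>Assumptions on the problem data\<close>

definition assumption1 :: "(real^'n \<Rightarrow> real) \<Rightarrow> bool" where
  "assumption1 f \<longleftrightarrow> (\<forall>\<alpha>. {x. f x \<le> \<alpha>} = {} \<or> compact {x. f x \<le> \<alpha>})"

definition assumption2 ::
    "(real^'n \<Rightarrow> real) \<Rightarrow> (real^'n \<Rightarrow> real^'m) \<Rightarrow> (real^'n) set
      \<Rightarrow> real \<Rightarrow> real \<Rightarrow> real \<Rightarrow> real \<Rightarrow> bool" where
  "assumption2 f F S M\<^sub>f M\<^sub>F L\<^sub>f L\<^sub>F \<longleftrightarrow>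
    M\<^sub>f > 0 \<and> M\<^sub>F > 0 \<and> L\<^sub>f > 0 \<and> L\<^sub>F > 0 \<and>
    (\<forall>x\<in>S. \<forall>y\<in>S.
      norm (grad f x) \<le> M\<^sub>f \<and>
      norm (grad f x - grad f y) \<le> L\<^sub>f * norm (x - y) \<and>
      spectral_norm (Jac F x) \<le> M\<^sub>F \<and>
      spectral_norm (Jac F x - Jac F y) \<le> L\<^sub>F * norm (x - y)) \<and>
    (\<forall>x\<in>S. rows_independent (Jac F x))"

definition assumption3 ::
    "(real^'n \<Rightarrow> real) \<Rightarrow> (real^'n \<Rightarrow> real^'m) \<Rightarrow> real \<Rightarrow> bool" where
  "assumption3 f F \<alpha>bar \<longleftrightarrow> (\<forall>x. norm (F x) \<le> 1 \<longrightarrow> f x \<le> \<alpha>bar)"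


section \<open>The penalty function and the criticality measure\<close>

definition penalty ::
    "(real^'n \<Rightarrow> real) \<Rightarrow> (real^'n \<Rightarrow> real^'m) \<Rightarrow> real \<Rightarrow> real \<Rightarrow> real^'n \<Rightarrow> real" where
  "penalty f F q \<rho> x = f x + \<rho> / q * qnorm q (F x) powr q"

definition lin_penalty ::
    "(real^'n \<Rightarrow> real) \<Rightarrow> (real^'n \<Rightarrow> real^'m) \<Rightarrow> real \<Rightarrow> real
      \<Rightarrow> real^'n \<Rightarrow> real^'n \<Rightarrow> real" where
  "lin_penalty f F q \<rho> x xbar =
    f xbar + grad f xbar \<bullet> (x - xbar)
      + \<rho> / q * qnorm q (F xbar + Jac F xbar *v (x - xbar)) powr q"

definition Psi ::
    "(real^'n \<Rightarrow> real) \<Rightarrow> (real^'n \<Rightarrow> real^'m) \<Rightarrow> real \<Rightarrow> real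
      \<Rightarrow> real \<Rightarrow> real^'n \<Rightarrow> real" where
  "Psi f F q \<rho> r x =
    penalty f F q \<rho> x - (INF y\<in>{y. norm (y - x) \<le> r}. lin_penalty f F q \<rho> y x)"

text \<open>The infimum in the definition of \<open>Psi\<close> is a minimum.\<close>

lemma Psi_attained:
  assumes "q > 0" "r \<ge> 0"
  obtains y where "norm (y - x) \<le> r"
    "\<And>z. norm (z - x) \<le> r \<Longrightarrow> lin_penalty f F q \<rho> y x \<le> lin_penalty f F q \<rho> z x"
    "Psi f F q \<rho> r x = penalty f F q \<rho> x - lin_penalty f F q \<rho> y x"
proof -
  have ball: "{y. norm (y - x) \<le> r} = cball x r"
    by (auto simp: dist_norm norm_minus_commute)
  have lin: "continuous_on A (\<lambda>y. Jac F x *v (y - x))" for A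
    using linear_continuous_on_compose[of A "\<lambda>y. y - x" "\<lambda>v. Jac F x *v v"]
    by (simp add: continuous_on_diff matrix_vector_mul_linear)
  have "continuous_on A (\<lambda>y. \<bar>(F x + Jac F x *v (y - x)) $ i\<bar> powr q)" for A i
    using \<open>q > 0\<close>
    by (intro continuous_on_powr' continuous_on_rabs continuous_on_component continuous_on_add
        continuous_on_const lin) auto
  then have "continuous_on (cball x r) (\<lambda>y. lin_penalty f F q \<rho> y x)"
    unfolding lin_penalty_def qnorm_powr[OF \<open>q > 0\<close>]
    by (intro continuous_on_add continuous_on_mult continuous_on_sum continuous_on_inner
        continuous_on_diff continuous_on_const continuous_on_id)
  then obtain y where y: "y \<in> cball x r"
    "\<And>z. z \<in> cball x r \<Longrightarrow> lin_penalty f F q \<rho> y x \<le> lin_penalty f F q \<rho> z x"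
    using continuous_attains_inf[OF compact_cball, of x r] \<open>r \<ge> 0\<close> by fastforce
  have "(INF z\<in>cball x r. lin_penalty f F q \<rho> z x) = lin_penalty f F q \<rho> y x"
    using y by (intro cInf_eq_minimum) auto
  then have "Psi f F q \<rho> r x = penalty f F q \<rho> x - lin_penalty f F q \<rho> y x"
    by (simp add: Psi_def ball)
  with y show ?thesis
    using that unfolding ball[symmetric] by blast
qed


section \<open>The linearized penalty algorithm\<close>

text \<open>\<open>x\<close> and \<open>\<beta>\<close> are the sequences of iterates and proximal parameters; \<open>\<beta> 0\<close> is never used.\<close>

definition qLP_sequence ::
    "(real^'n \<Rightarrow> real) \<Rightarrow> (real^'n \<Rightarrow> real^'m) \<Rightarrow> real \<Rightarrow> real \<Rightarrow> real
      \<Rightarrow> (nat \<Rightarrow> real) \<Rightarrow> (nat \<Rightarrow> real^'n) \<Rightarrow> bool" where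
  "qLP_sequence f F q \<rho> \<beta>low \<beta> x \<longleftrightarrow>
    \<rho> > 0 \<and> \<beta>low \<ge> 1 \<and>
    (\<forall>k. \<beta> (Suc k) \<ge> \<beta>low \<and>
      is_arg_min
        (\<lambda>y. lin_penalty f F q \<rho> y (x k) + \<beta> (Suc k) / 2 * (norm (y - x k))\<^sup>2)
        (\<lambda>_. True) (x (Suc k)) \<and>
      penalty f F q \<rho> (x (Suc k))
        \<le> lin_penalty f F q \<rho> (x (Suc k)) (x k)
          + \<beta> (Suc k) / 2 * (norm (x (Suc k) - x k))\<^sup>2)"

definition beta_bound ::
    "(real^'n \<Rightarrow> real) \<Rightarrow> (real^'n \<Rightarrow> real^'m) \<Rightarrow> real \<Rightarrow> real \<Rightarrow> real \<Rightarrow> real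
      \<Rightarrow> real \<Rightarrow> real \<Rightarrow> real \<Rightarrow> real" where
  "beta_bound f F q L\<^sub>f L\<^sub>F \<alpha>bar c\<^sub>0 \<mu> \<rho> =
    (let m = real CARD('m); Pbar = \<alpha>bar + c\<^sub>0; fbar = (INF x. f x) in
      \<mu> * (L\<^sub>f + (3 * m powr ((2 - q) * (q - 1) / (2 * q)) * 2 powr (2 - q)) powr (1 / q)
                * q powr ((q - 1) / q) * \<rho> powr (1 / q) * L\<^sub>F
                * (Pbar - fbar) powr ((q - 1) / q)))"

text \<open>A run of the algorithm inside \<open>S\<close> with an admissible penalty parameter, starting point and
  proximal parameters.\<close>

definition admissible_run ::
    "(real^'n \<Rightarrow> real) \<Rightarrow> (real^'n \<Rightarrow> real^'m) \<Rightarrow> real \<Rightarrow> (real^'n) set \<Rightarrow> real \<Rightarrow> real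
      \<Rightarrow> real \<Rightarrow> real \<Rightarrow> real \<Rightarrow> real
      \<Rightarrow> real \<Rightarrow> real \<Rightarrow> (nat \<Rightarrow> real) \<Rightarrow> (nat \<Rightarrow> real^'n) \<Rightarrow> bool" where
  "admissible_run f F q S L\<^sub>f L\<^sub>F \<alpha>bar c\<^sub>0 \<rho>\<^sub>0 \<mu> \<rho> \<beta>low \<beta> x \<longleftrightarrow>
    \<rho> \<ge> max 1 ((q + 1) * \<rho>\<^sub>0) \<and>
    qLP_sequence f F q \<rho> \<beta>low \<beta> x \<and>
    range x \<subseteq> S \<and>
    qnorm q (F (x 0)) powr q \<le> min 1 (q * c\<^sub>0 / \<rho>) \<and>
    bdd_above (\<beta> ` {1..}) \<and>
    (SUP k\<in>{1..}. \<beta> k) \<le> beta_bound f F q L\<^sub>f L\<^sub>F \<alpha>bar c\<^sub>0 \<mu> \<rho>"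

definition eps_first_order_solution ::
    "(real^'n \<Rightarrow> real) \<Rightarrow> (real^'n \<Rightarrow> real^'m) \<Rightarrow> real \<Rightarrow> real^'n \<Rightarrow> bool" where
  "eps_first_order_solution f F \<epsilon> x \<longleftrightarrow>
    (\<exists>lam \<kappa>\<^sub>1 \<kappa>\<^sub>2. \<kappa>\<^sub>1 > 0 \<and> \<kappa>\<^sub>2 > 0 \<and>
      norm (grad f x + transpose (Jac F x) *v lam) \<le> \<kappa>\<^sub>1 * \<epsilon> \<and>
      norm (F x) \<le> \<kappa>\<^sub>2 * \<epsilon>)"

end

theory Submission
  imports Defs
begin

text \<open>
  The linearized penalty \<open>y \<mapsto> lin_penalty f F q \<rho> y x\<close> is convex and differentiable, with gradient
  \<open>grad f x + (Jac F x)\<^sup>T \<lambda>(y)\<close> where \<open>\<bar>\<lambda>\<^sub>i(y)\<bar> = \<rho> \<bar>u\<^sub>i\<bar> powr (q - 1)\<close> and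
  \<open>u = F x + Jac F x (y - x)\<close>. If \<open>y\<close> minimizes it on the ball of radius \<open>\<epsilon>\<close> around \<open>x\<close> and \<open>G\<close>
  is the gradient at \<open>y\<close>, then comparing \<open>y\<close> with the point of the ball in direction \<open>- G\<close> and using
  convexity gives \<open>\<epsilon> norm G \<le> Psi \<le> \<epsilon>\<^sup>2\<close>; so \<open>\<lambda>(y)\<close> is the required multiplier. By compactness
  LICQ holds uniformly on \<open>S\<close>, so \<open>\<lambda>(y)\<close> is bounded independently of \<open>\<rho>\<close>; with
  \<open>\<rho> \<ge> c\<^sub>1 / \<epsilon> powr (q - 1)\<close> this gives \<open>u = O(\<epsilon>)\<close>, hence \<open>F x = O(\<epsilon>)\<close>.

  While \<open>Psi > \<epsilon>\<^sup>2\<close>, testing the proximal subproblem with the step \<open>(y - x) / \<beta>\<close> shows that each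
  iteration decreases the penalty by at least \<open>\<epsilon>\<^sup>2 / (2 \<beta>)\<close>, where
  \<open>\<beta> = O(\<rho> powr (1 / q)) = O(\<epsilon> powr - ((q - 1) / q))\<close>; the total decrease is bounded
  independently of \<open>\<rho>\<close>.
\<close>

section \<open>Convexity of the linearized penalty\<close>

text \<open>The convention \<open>sgn 0 = 0\<close> lets one formula cover the origin: there the
  difference quotient has modulus \<open>\<bar>h\<bar> powr (q - 1)\<close>, which tends to 0
  because \<open>q > 1\<close>.\<close>

lemma has_real_derivative_abs_powr:
  fixes q :: real
  assumes "q > 1"
  shows "((\<lambda>s. \<bar>s\<bar> powr q) has_real_derivative q * sgn s * \<bar>s\<bar> powr (q - 1)) (at s)"
proof (cases "s = 0")
  case True
  have "((\<lambda>h::real. \<bar>h\<bar> powr (q - 1)) \<longlongrightarrow> 0) (at 0)"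
    using assms by (auto intro!: tendsto_eq_intros)
  moreover have "\<forall>\<^sub>F h::real in at 0. norm (\<bar>h\<bar> powr q / h) \<le> \<bar>h\<bar> powr (q - 1)"
    by (rule eventuallyI) (auto simp: powr_diff)
  ultimately have "((\<lambda>h::real. \<bar>h\<bar> powr q / h) \<longlongrightarrow> 0) (at 0)"
    by (rule Lim_null_comparison[rotated])
  then show ?thesis
    using True by (simp add: DERIV_def)
next
  case False
  then have "((\<lambda>s. \<bar>s\<bar>) has_real_derivative sgn s) (at s)"
    using GDERIV_norm[of s] by (simp add: gderiv_def has_field_derivative_def mult_commute_abs)
  from DERIV_chain2[OF has_real_derivative_powr this, of q] False show ?thesis
    by (simp add: mult_ac)
qed

lemma convex_on_abs_powr:
  fixes q :: real
  assumes "q > 1"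
  shows "convex_on UNIV (\<lambda>s. \<bar>s\<bar> powr q)"
proof (rule convex_on_realI[OF _ has_real_derivative_abs_powr[OF assms]])
  fix x y :: real
  assume "x \<le> y"
  have "sgn x * \<bar>x\<bar> powr (q - 1) \<le> sgn y * \<bar>y\<bar> powr (q - 1)"
  \<comment> \<open>Here the left side is nonpositive and the right side nonnegative. Otherwise
    \<open>x\<close> and \<open>y\<close> are nonzero with equal signs, and monotonicity of the
    power decides.\<close>
  proof (cases "x < 0 \<and> y > 0 \<or> x = 0 \<or> y = 0")
    case True
    then show ?thesis
      using \<open>x \<le> y\<close> add_nonneg_nonneg[OF powr_ge_zero powr_ge_zero, of "- x" "q - 1" y "q - 1"]
      by (auto simp: sgn_if simp del: powr_ge_zero)
  next
    case False
    then show ?thesis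
      using \<open>x \<le> y\<close> assms by (auto simp: sgn_if intro!: powr_mono2)
  qed
  then show "q * sgn x * \<bar>x\<bar> powr (q - 1) \<le> q * sgn y * \<bar>y\<bar> powr (q - 1)"
    using assms by (simp add: mult.assoc)
qed auto

lemma abs_powr_above_tangent:
  fixes q :: real
  assumes "q > 1"
  shows "\<bar>s\<bar> powr q + q * sgn s * \<bar>s\<bar> powr (q - 1) * (t - s) \<le> \<bar>t\<bar> powr q"
  using convex_on_imp_above_tangent[OF convex_on_abs_powr[OF assms], of s t
      "q * sgn s * \<bar>s\<bar> powr (q - 1)"] has_real_derivative_abs_powr[OF assms, of s]
  by simp

text \<open>This is the gradient of \<open>\<rho> / q * qnorm q v powr q\<close> at
  \<open>v = u\<close>; differentiation produces a factor \<open>q\<close> that cancels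
  \<open>1 / q\<close>.\<close>

definition q_multiplier :: "real \<Rightarrow> real \<Rightarrow> real^'m \<Rightarrow> real^'m" where
  "q_multiplier q \<rho> u = (\<chi> i. \<rho> * sgn (u $ i) * \<bar>u $ i\<bar> powr (q - 1))"

definition lin_penalty_grad ::
    "(real^'n \<Rightarrow> real) \<Rightarrow> (real^'n \<Rightarrow> real^'m) \<Rightarrow> real \<Rightarrow> real \<Rightarrow> real^'n \<Rightarrow> real^'n \<Rightarrow> real^'n" where
  "lin_penalty_grad f F q \<rho> y x =
    grad f x + transpose (Jac F x) *v q_multiplier q \<rho> (F x + Jac F x *v (y - x))"

lemma inner_transpose_mult_left:
  fixes A :: "real^'n^'m"
  shows "(transpose A *v w) \<bullet> v = w \<bullet> (A *v v)"
  by (simp add: dot_lmul_matrix)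

lemma lin_penalty_sum:
  assumes "q > 0"
  shows "lin_penalty f F q \<rho> y x = f x + grad f x \<bullet> (y - x)
    + \<rho> / q * (\<Sum>i\<in>UNIV. \<bar>(F x + Jac F x *v (y - x)) $ i\<bar> powr q)"
  by (simp add: lin_penalty_def qnorm_powr[OF assms])

lemma lin_penalty_self [simp]: "lin_penalty f F q \<rho> x x = penalty f F q \<rho> x"
  by (simp add: lin_penalty_def penalty_def)

lemma lin_penalty_grad_inner:
  "lin_penalty_grad f F q \<rho> y x \<bullet> v = grad f x \<bullet> v
    + (\<Sum>i\<in>UNIV. \<rho> * sgn ((F x + Jac F x *v (y - x)) $ i)
        * \<bar>(F x + Jac F x *v (y - x)) $ i\<bar> powr (q - 1) * (Jac F x *v v) $ i)"
  unfolding lin_penalty_grad_def inner_add_left inner_transpose_mult_left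
    inner_vec_def[of "q_multiplier _ _ _"]
  by (simp add: q_multiplier_def)

text \<open>The residual is affine in the point, so its change from \<open>y\<close> to
  \<open>z\<close> is exactly the Jacobian applied to \<open>z - y\<close>. Summing the scalar
  tangent inequality over the components therefore suffices.\<close>

lemma lin_penalty_above_tangent:
  assumes "q > 1" "\<rho> \<ge> 0"
  shows "lin_penalty f F q \<rho> y x + lin_penalty_grad f F q \<rho> y x \<bullet> (z - y)
    \<le> lin_penalty f F q \<rho> z x"
proof -
  define u where "u = F x + Jac F x *v (y - x)"
  define w where "w = F x + Jac F x *v (z - x)"
  have J: "(Jac F x *v (z - y)) = w - u"
    by (simp add: u_def w_def matrix_vector_mult_diff_distrib)
  have "(\<Sum>i\<in>UNIV. \<bar>u $ i\<bar> powr q + q * sgn (u $ i) * \<bar>u $ i\<bar> powr (q - 1) * (w $ i - u $ i))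
      \<le> (\<Sum>i\<in>UNIV. \<bar>w $ i\<bar> powr q)"
    by (intro sum_mono abs_powr_above_tangent assms)
  then have "\<rho> / q * (\<Sum>i\<in>UNIV. \<bar>u $ i\<bar> powr q
        + q * sgn (u $ i) * \<bar>u $ i\<bar> powr (q - 1) * (w $ i - u $ i))
      \<le> \<rho> / q * (\<Sum>i\<in>UNIV. \<bar>w $ i\<bar> powr q)"
    using assms by (intro mult_left_mono) auto
  moreover have "\<rho> / q * (\<Sum>i\<in>UNIV. \<bar>u $ i\<bar> powr q
        + q * sgn (u $ i) * \<bar>u $ i\<bar> powr (q - 1) * (w $ i - u $ i))
      = \<rho> / q * (\<Sum>i\<in>UNIV. \<bar>u $ i\<bar> powr q)
        + (\<Sum>i\<in>UNIV. \<rho> * sgn (u $ i) * \<bar>u $ i\<bar> powr (q - 1) * (w $ i - u $ i))"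
    using assms by (simp add: sum.distrib distrib_left sum_distrib_left mult.assoc)
  ultimately show ?thesis
    using assms
    by (simp add: lin_penalty_sum lin_penalty_grad_inner J flip: u_def w_def)
      (simp add: inner_diff_right)
qed

text \<open>Directional derivatives at \<open>y\<close> are all that the optimality condition on the
  ball requires, which reduces the claim to one-variable calculus in each component.\<close>

lemma lin_penalty_has_real_derivative:
  assumes "q > 1"
  shows "((\<lambda>t. lin_penalty f F q \<rho> (y + t *\<^sub>R v) x) has_real_derivative
    lin_penalty_grad f F q \<rho> y x \<bullet> v) (at 0)"
proof -
  define u where "u = F x + Jac F x *v (y - x)"
  define w where "w = Jac F x *v v"
  have J: "F x + Jac F x *v (y + t *\<^sub>R v - x) = u + t *\<^sub>R w" for t
    by (simp add: u_def w_def matrix_vector_right_distrib matrix_vector_mult_diff_distrib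
        scaleR_matrix_vector_assoc algebra_simps flip: scalar_mult_eq_scaleR vector_scalar_commute)
  have *: "((\<lambda>t. \<bar>u $ i + t * w $ i\<bar> powr q) has_real_derivative
      q * sgn (u $ i) * \<bar>u $ i\<bar> powr (q - 1) * w $ i) (at 0)" for i
    by (rule DERIV_chain2[where f = "\<lambda>s. \<bar>s\<bar> powr q" and g = "\<lambda>t. u $ i + t * w $ i"])
      (use has_real_derivative_abs_powr[OF assms, of "u $ i"] in
        \<open>auto intro!: derivative_eq_intros\<close>)
  have "((\<lambda>t. f x + (grad f x \<bullet> (y - x) + t * (grad f x \<bullet> v))
        + \<rho> / q * (\<Sum>i\<in>UNIV. \<bar>u $ i + t * w $ i\<bar> powr q)) has_real_derivative
      grad f x \<bullet> v
        + \<rho> / q * (\<Sum>i\<in>UNIV. q * sgn (u $ i) * \<bar>u $ i\<bar> powr (q - 1) * w $ i)) (at 0)"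
    by (rule derivative_eq_intros * refl | simp)+
  moreover have "grad f x \<bullet> (y + t *\<^sub>R v - x) = grad f x \<bullet> (y - x) + t * (grad f x \<bullet> v)" for t
    by (simp add: algebra_simps inner_add_right inner_diff_right)
  moreover have "\<rho> / q * (\<Sum>i\<in>UNIV. q * sgn (u $ i) * \<bar>u $ i\<bar> powr (q - 1) * w $ i)
      = (\<Sum>i\<in>UNIV. \<rho> * sgn (u $ i) * \<bar>u $ i\<bar> powr (q - 1) * w $ i)"
    using assms by (simp add: sum_distrib_left mult.assoc)
  ultimately show ?thesis
    using assms by (simp add: lin_penalty_sum lin_penalty_grad_inner J flip: u_def w_def)
qed

text \<open>Tangent inequalities at the intermediate point, evaluated at the two endpoints and
  weighted by \<open>1 - t\<close> and \<open>t\<close>, add up so that the gradient terms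
  cancel.\<close>

lemma lin_penalty_convex_combination:
  assumes "q > 1" "\<rho> \<ge> 0" "0 \<le> t" "t \<le> 1"
  shows "lin_penalty f F q \<rho> (x + t *\<^sub>R d) x
    \<le> (1 - t) * penalty f F q \<rho> x + t * lin_penalty f F q \<rho> (x + d) x"
proof -
  define y where "y = x + t *\<^sub>R d"
  define G where "G = lin_penalty_grad f F q \<rho> y x"
  have "lin_penalty f F q \<rho> y x + G \<bullet> (x - y) \<le> lin_penalty f F q \<rho> x x"
    and "lin_penalty f F q \<rho> y x + G \<bullet> (x + d - y) \<le> lin_penalty f F q \<rho> (x + d) x"
    unfolding G_def by (rule lin_penalty_above_tangent[OF assms(1,2)])+
  moreover have "x - y = (- t) *\<^sub>R d" "x + d - y = (1 - t) *\<^sub>R d"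
    by (auto simp: y_def algebra_simps)
  ultimately have "(1 - t) * (lin_penalty f F q \<rho> y x - t * (G \<bullet> d)) \<le> (1 - t) * penalty f F q \<rho> x"
    and "t * (lin_penalty f F q \<rho> y x + (1 - t) * (G \<bullet> d)) \<le> t * lin_penalty f F q \<rho> (x + d) x"
    using assms by (auto intro!: mult_left_mono)
  then show ?thesis
    unfolding y_def[symmetric] by (simp add: algebra_simps)
qed


section \<open>First-order optimality from the criticality measure\<close>

lemma lin_penalty_minimizer_variational:
  assumes "q > 1" "norm (y - x) \<le> r" "norm (z - x) \<le> r"
    and min: "\<And>w. norm (w - x) \<le> r \<Longrightarrow> lin_penalty f F q \<rho> y x \<le> lin_penalty f F q \<rho> w x"
  shows "0 \<le> lin_penalty_grad f F q \<rho> y x \<bullet> (z - y)"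
proof (rule ccontr)
  assume "\<not> ?thesis"
  then obtain d where d: "d > 0"
    "\<And>h. 0 < h \<Longrightarrow> h < d \<Longrightarrow>
      lin_penalty f F q \<rho> (y + h *\<^sub>R (z - y)) x < lin_penalty f F q \<rho> y x"
    using DERIV_neg_dec_right[OF lin_penalty_has_real_derivative[OF \<open>q > 1\<close>]]
    by (metis add_0 add.right_neutral not_le scaleR_zero_left)
  \<comment> \<open>Halving keeps \<open>h\<close> strictly below \<open>d\<close>; the cap 1 makes
    the new point a convex combination of \<open>y\<close> and \<open>z\<close>, which stays in the
    ball.\<close>
  define h where "h = min (d / 2) 1"
  have h: "0 < h" "h < d" "h \<le> 1"
    using d(1) by (auto simp: h_def)
  have "y + h *\<^sub>R (z - y) - x = (1 - h) *\<^sub>R (y - x) + h *\<^sub>R (z - x)"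
    by (simp add: algebra_simps)
  also have "norm \<dots> \<le> (1 - h) * norm (y - x) + h * norm (z - x)"
    using h by (intro norm_triangle_le) auto
  also have "\<dots> \<le> (1 - h) * r + h * r"
    using h assms(2,3) by (intro add_mono mult_left_mono) auto
  finally have "norm (y + h *\<^sub>R (z - y) - x) \<le> r"
    by (simp add: algebra_simps)
  with min d(2)[OF h(1,2)] show False
    by force
qed

lemma Psi_minimizer_grad_bound:
  assumes "q > 1" "\<rho> \<ge> 0" "r > 0"
  obtains y where "norm (y - x) \<le> r" "r * norm (lin_penalty_grad f F q \<rho> y x) \<le> Psi f F q \<rho> r x"
proof -
  obtain y where y: "norm (y - x) \<le> r"
    "\<And>z. norm (z - x) \<le> r \<Longrightarrow> lin_penalty f F q \<rho> y x \<le> lin_penalty f F q \<rho> z x"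
    "Psi f F q \<rho> r x = penalty f F q \<rho> x - lin_penalty f F q \<rho> y x"
    using Psi_attained[of q r x f F \<rho>] assms by (metis less_eq_real_def less_trans zero_less_one)
  define G where "G = lin_penalty_grad f F q \<rho> y x"
  \<comment> \<open>This point minimizes the linear function with gradient \<open>G\<close> over the
    ball; for \<open>G = 0\<close> it is the centre.\<close>
  define z where "z = x - r *\<^sub>R sgn G"
  have "norm (z - x) \<le> r"
    using \<open>r > 0\<close> by (simp add: z_def norm_sgn)
  then have "0 \<le> G \<bullet> (z - y)"
    unfolding G_def using lin_penalty_minimizer_variational[OF \<open>q > 1\<close> y(1)] y(2) by blast
  also have "z - y = (x - y) - r *\<^sub>R sgn G"
    by (simp add: z_def)
  also have "G \<bullet> \<dots> = G \<bullet> (x - y) - r * norm G"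
    by (cases "G = 0") (auto simp: inner_diff_right sgn_div_norm dot_square_norm power2_eq_square)
  \<comment> \<open>It remains to bound \<open>G \<bullet> (x - y)\<close> by \<open>Psi\<close>:
    this is the tangent inequality at \<open>y\<close> evaluated at the centre \<open>x\<close>,
    where the model equals the penalty.\<close>
  finally have "r * norm G \<le> Psi f F q \<rho> r x"
    using lin_penalty_above_tangent[OF assms(1,2), of f F y x x] y(3) by (simp add: G_def)
  with y(1) show ?thesis
    using that G_def by blast
qed


section \<open>Feasibility\<close>

text \<open>Uniqueness of derivatives identifies the Jacobian with the derivative supplied by
  \<open>C1\<close>, whose continuity can then be used.\<close>

lemma Jac_mult_eq:
  assumes "(F has_derivative F') (at x)"
  shows "Jac F x *v h = F' h"
proof -
  have "(F has_derivative (\<lambda>h. Jac F x *v h)) (at x)"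
    using assms jacobian_works differentiable_def by blast
  then show ?thesis
    using assms has_derivative_unique by metis
qed

text \<open>Applying the transpose to \<open>w\<close> forms the combination of the rows with
  coefficients \<open>w\<close>, so LICQ is injectivity of the transpose, a property that
  compactness can make quantitative.\<close>

lemma rows_independent_iff:
  fixes A :: "real^'n^'m"
  shows "rows_independent A \<longleftrightarrow> (\<forall>w. transpose A *v w = 0 \<longrightarrow> w = 0)"
proof -
  have *: "transpose A *v w = (\<Sum>i\<in>UNIV. w $ i *\<^sub>R row i A)" for w
    by (simp add: vec_eq_iff matrix_vector_mult_def transpose_def row_def mult.commute
        del: transpose_matrix_vector)
  show ?thesis
  proof (intro iffI allI impI)
    fix w
    assume "rows_independent A" "transpose A *v w = 0"
    then show "w = 0"
      unfolding rows_independent_def * by (simp add: vec_eq_iff)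
  next
    assume R: "\<forall>w. transpose A *v w = 0 \<longrightarrow> w = 0"
    show "rows_independent A"
      unfolding rows_independent_def
    proof (intro allI impI)
      fix c i
      assume "(\<Sum>i\<in>UNIV. c i *\<^sub>R row i A) = 0"
      then have "transpose A *v (\<chi> i. c i) = 0"
        unfolding * by simp
      with R have "(\<chi> i. c i) = 0"
        by blast
      then show "c i = 0"
        by (simp add: vec_eq_iff)
    qed
  qed
qed

text \<open>The constant is the minimum of the right-hand side over \<open>S\<close> times the unit
  sphere: attained by compactness, positive by injectivity, and valid for all \<open>w\<close> by
  homogeneity.\<close>

lemma uniform_LICQ:
  fixes F :: "real^'n \<Rightarrow> real^'m"
  assumes "C1 F" "compact S" "\<And>x. x \<in> S \<Longrightarrow> rows_independent (Jac F x)"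
  obtains \<sigma> where "\<sigma> > 0"
    "\<And>x w. x \<in> S \<Longrightarrow> \<sigma> * norm w \<le> norm (transpose (Jac F x) *v w)"
proof (cases "S = {}")
  case True
  then show ?thesis
    using that[of 1] by simp
next
  case False
  obtain F' where F': "\<And>x. (F has_derivative blinfun_apply (F' x)) (at x)" "continuous_on UNIV F'"
    using assms(1) by (auto simp: C1_def)
  let ?g = "\<lambda>(x, w). norm (transpose (Jac F x) *v w)"
  \<comment> \<open>Written in coordinates through \<open>F'\<close>, the map is visibly jointly
    continuous in \<open>x\<close> and \<open>w\<close>.\<close>
  have comp: "transpose (Jac F x) *v w = (\<chi> j. w \<bullet> F' x (axis j 1))" for x w
  proof -
    have "(transpose (Jac F x) *v w) $ j = w \<bullet> F' x (axis j 1)" for j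
      unfolding cart_eq_inner_axis inner_transpose_mult_left Jac_mult_eq[OF F'(1)] ..
    then show ?thesis
      by (simp add: vec_eq_iff del: transpose_matrix_vector)
  qed
  have "continuous_on (S \<times> sphere 0 1) ?g"
    unfolding comp split_def
    by (intro continuous_intros continuous_on_compose2[OF F'(2)]) auto
  moreover have "sphere (0::real^'m) 1 \<noteq> {}"
    by simp
  ultimately obtain x0 w0 where m: "x0 \<in> S" "norm w0 = 1"
    "\<And>x w. x \<in> S \<Longrightarrow> norm w = 1 \<Longrightarrow>
      norm (transpose (Jac F x0) *v w0) \<le> norm (transpose (Jac F x) *v w)"
    using continuous_attains_inf[of "S \<times> sphere 0 1" ?g] False \<open>compact S\<close>
    by (fastforce simp: compact_Times simp del: transpose_matrix_vector)
  define \<sigma> where "\<sigma> = norm (transpose (Jac F x0) *v w0)"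
  show ?thesis
  proof
    show "\<sigma> > 0"
      using m(1,2) assms(3)[OF m(1)] unfolding rows_independent_iff \<sigma>_def
      by (metis norm_eq_zero zero_less_norm_iff zero_neq_one)
  next
    fix x w
    assume "x \<in> S"
    show "\<sigma> * norm w \<le> norm (transpose (Jac F x) *v w)"
    proof (cases "w = 0")
      case False
      then have "\<sigma> \<le> norm (transpose (Jac F x) *v sgn w)"
        unfolding \<sigma>_def using m(3)[OF \<open>x \<in> S\<close>] by (simp add: norm_sgn)
      also have "\<dots> = norm (transpose (Jac F x) *v w) / norm w"
        by (simp add: sgn_div_norm matrix_vector_mult_scaleR divide_inverse mult.commute
            del: transpose_matrix_vector)
      finally show ?thesis
        using False by (simp add: field_simps)
    qed simp
  qed
qed

lemma norm_mult_le_spectral_norm: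
  fixes A :: "real^'n^'m"
  shows "norm (A *v v) \<le> spectral_norm A * norm v"
  unfolding spectral_norm_def
  by (rule onorm) (simp add: linear_conv_bounded_linear[symmetric] matrix_vector_mul_linear)

text \<open>Each component satisfies \<open>\<rho> * \<bar>u $ i\<bar> powr (q - 1) \<le> B\<close>;
  inserting the lower bound on \<open>\<rho>\<close> and taking the root of order
  \<open>q - 1\<close> gives a multiple of \<open>\<epsilon>\<close>. The factor
  \<open>CARD('m)\<close> comes from passing through the 1-norm.\<close>

lemma norm_le_of_q_multiplier_bound:
  fixes u :: "real^'m"
  assumes "q > 1" "c > 0" "\<epsilon> > 0" "c / \<epsilon> powr (q - 1) \<le> \<rho>" "norm (q_multiplier q \<rho> u) \<le> B"
  shows "norm u \<le> real CARD('m) * (B / c) powr (1 / (q - 1)) * \<epsilon>"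
proof -
  have "\<bar>u $ i\<bar> \<le> (B / c) powr (1 / (q - 1)) * \<epsilon>" for i
  proof (cases "u $ i = 0")
    case False
    have "0 < c / \<epsilon> powr (q - 1)"
      using assms by simp
    with assms(4) have "\<rho> > 0"
      by linarith
    have "c / \<epsilon> powr (q - 1) * \<bar>u $ i\<bar> powr (q - 1) \<le> \<rho> * \<bar>u $ i\<bar> powr (q - 1)"
      using assms by (intro mult_right_mono) auto
    also have "\<dots> = \<bar>q_multiplier q \<rho> u $ i\<bar>"
      using False \<open>\<rho> > 0\<close> by (simp add: q_multiplier_def abs_mult abs_sgn_eq)
    also have "\<dots> \<le> B"
      using component_le_norm_cart assms(5) order_trans by blast
    finally have "\<bar>u $ i\<bar> powr (q - 1) \<le> B / c * \<epsilon> powr (q - 1)"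
      using assms by (simp add: field_simps)
    then have "(\<bar>u $ i\<bar> powr (q - 1)) powr (1 / (q - 1))
        \<le> (B / c * \<epsilon> powr (q - 1)) powr (1 / (q - 1))"
      using assms by (intro powr_mono2) auto
    moreover have "B \<ge> 0"
      using assms(5) norm_ge_zero order_trans by blast
    moreover have "(B / c * \<epsilon> powr (q - 1)) powr (1 / (q - 1)) = (B / c) powr (1 / (q - 1)) * \<epsilon>"
      using assms \<open>B \<ge> 0\<close> by (subst powr_mult) (auto simp: powr_powr)
    ultimately show ?thesis
      using assms by (simp add: powr_powr)
  qed (use \<open>\<epsilon> > 0\<close> in simp)
  then have "(\<Sum>i\<in>UNIV. \<bar>u $ i\<bar>) \<le> (\<Sum>i\<in>(UNIV::'m set). (B / c) powr (1 / (q - 1)) * \<epsilon>)"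
    by (intro sum_mono)
  with norm_le_l1_cart[of u] show ?thesis
    by (simp add: mult.assoc)
qed


section \<open>Descent and iteration count\<close>

lemma qLP_sequence_beta_ge_1:
  "qLP_sequence f F q \<rho> \<beta>low \<beta> x \<Longrightarrow> \<beta> (Suc k) \<ge> 1"
  by (auto simp: qLP_sequence_def intro: order_trans)

lemma qLP_sequence_descent:
  assumes "q > 1" "r > 0" and qLP: "qLP_sequence f F q \<rho> \<beta>low \<beta> x"
    and Psi: "Psi f F q \<rho> r (x k) > r\<^sup>2"
  shows "penalty f F q \<rho> (x (Suc k)) + r\<^sup>2 / (2 * \<beta> (Suc k)) \<le> penalty f F q \<rho> (x k)"
proof -
  define b where "b = \<beta> (Suc k)"
  have "b \<ge> 1" "\<rho> > 0"
    using qLP_sequence_beta_ge_1[OF qLP] qLP by (auto simp: b_def qLP_sequence_def)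
  obtain y where y: "norm (y - x k) \<le> r"
    "Psi f F q \<rho> r (x k) = penalty f F q \<rho> (x k) - lin_penalty f F q \<rho> y (x k)"
    using Psi_attained[of q r "x k" f F \<rho>] assms(1,2)
    by (metis less_eq_real_def less_trans zero_less_one)
  define d where "d = y - x k"
  \<comment> \<open>The step \<open>t *\<^sub>R d\<close> gains at least
    \<open>t * r\<^sup>2\<close> in the model and costs at most
    \<open>b * t\<^sup>2 * r\<^sup>2 / 2\<close> in the proximal term; \<open>1 / b\<close>
    maximizes the difference, and \<open>b \<ge> 1\<close> keeps it in the unit interval.\<close>
  define t where "t = 1 / b"
  have t: "0 < t" "t \<le> 1"
    using \<open>b \<ge> 1\<close> by (auto simp: t_def)
  have "penalty f F q \<rho> (x (Suc k))
      \<le> lin_penalty f F q \<rho> (x (Suc k)) (x k) + b / 2 * (norm (x (Suc k) - x k))\<^sup>2"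
    using qLP unfolding qLP_sequence_def b_def by blast
  also have "\<dots> \<le> lin_penalty f F q \<rho> (x k + t *\<^sub>R d) (x k)
      + b / 2 * (norm (x k + t *\<^sub>R d - x k))\<^sup>2"
    using qLP unfolding qLP_sequence_def is_arg_min_linorder b_def by blast
  also have "\<dots> = lin_penalty f F q \<rho> (x k + t *\<^sub>R d) (x k) + (norm d)\<^sup>2 / (2 * b)"
    using \<open>b \<ge> 1\<close> by (simp add: t_def power_mult_distrib power_divide power2_eq_square)
  also have "\<dots> \<le> ((1 - t) * penalty f F q \<rho> (x k) + t * lin_penalty f F q \<rho> (x k + d) (x k))
      + r\<^sup>2 / (2 * b)"
    using y(1) t \<open>b \<ge> 1\<close> \<open>\<rho> > 0\<close> \<open>q > 1\<close>
    by (intro add_mono lin_penalty_convex_combination divide_right_mono power_mono)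
      (auto simp: d_def)
  also have "\<dots> = penalty f F q \<rho> (x k) - t * Psi f F q \<rho> r (x k) + r\<^sup>2 / (2 * b)"
    by (simp add: y(2) d_def algebra_simps)
  also have "\<dots> \<le> penalty f F q \<rho> (x k) - t * r\<^sup>2 + r\<^sup>2 / (2 * b)"
    using Psi t by simp
  also have "\<dots> = penalty f F q \<rho> (x k) - r\<^sup>2 / (2 * b)"
    using \<open>b \<ge> 1\<close> by (simp add: t_def field_simps)
  finally show ?thesis
    by (simp add: b_def)
qed

section \<open>Bounds for the total decrease and the number of iterations\<close>

lemma bdd_below_of_assumption1:
  assumes "assumption1 f" "C1 f"
  shows "bdd_below (range f)"
proof -
  have cont: "continuous_on UNIV f"
    using assms(2) unfolding C1_def
    by (meson has_derivative_at_withinI has_derivative_continuous_on)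
  \<comment> \<open>This sublevel set contains the origin, hence is nonempty. A minimizer on it is
    global, since \<open>f\<close> exceeds \<open>f 0\<close> elsewhere.\<close>
  have "compact {x. f x \<le> f 0}"
    using assms(1) by (auto simp: assumption1_def)
  moreover have "{x. f x \<le> f 0} \<noteq> {}"
    by auto
  ultimately obtain y where "f y \<le> f 0" "\<And>z. f z \<le> f 0 \<Longrightarrow> f y \<le> f z"
    using continuous_attains_inf[of "{x. f x \<le> f 0}" f] continuous_on_subset[OF cont] by auto
  then have "f y \<le> f z" for z
    by (meson le_cases order_trans)
  then show ?thesis
    by (auto intro: bdd_belowI[where m = "f y"])
qed

text \<open>All components are at most 1 in modulus, so with \<open>q \<le> 2\<close> squaring gives
  no more than the power \<open>q\<close>. This makes Assumption 3, stated for the Euclidean norm,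
  applicable to the starting point.\<close>

lemma norm_le_1_of_qnorm_le_1:
  fixes v :: "real^'m"
  assumes "0 < q" "q \<le> 2" "qnorm q v powr q \<le> 1"
  shows "norm v \<le> 1"
proof -
  have S: "(\<Sum>i\<in>UNIV. \<bar>v $ i\<bar> powr q) \<le> 1"
    using assms by (simp add: qnorm_powr)
  have "(v $ i)\<^sup>2 \<le> \<bar>v $ i\<bar> powr q" for i
  proof -
    have "\<bar>v $ i\<bar> powr q \<le> 1"
      using member_le_sum[of i UNIV "\<lambda>i. \<bar>v $ i\<bar> powr q"] S by auto
    then have "\<bar>v $ i\<bar> \<le> 1"
      using \<open>0 < q\<close> gr_one_powr[of "\<bar>v $ i\<bar>" q] by fastforce
    then show ?thesis
      using powr_mono'[OF \<open>q \<le> 2\<close>, of "\<bar>v $ i\<bar>"] by simp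
  qed
  then have "(\<Sum>i\<in>UNIV. (v $ i)\<^sup>2) \<le> 1"
    using S sum_mono order_trans by (metis (no_types, lifting))
  then show ?thesis
    by (simp add: norm_vec_def L2_set_def)
qed

text \<open>The second summand scales exactly like \<open>\<rho> powr (1 / q)\<close>, and
  \<open>\<rho> \<ge> 1\<close> lets the summand with \<open>L\<^sub>f\<close> be absorbed; this
  isolates the dependence on \<open>\<rho>\<close>.\<close>

lemma beta_bound_le:
  fixes F :: "real^'n \<Rightarrow> real^'m"
  assumes "\<rho> \<ge> 1" "q > 0" "\<mu> \<ge> 0" "L\<^sub>f \<ge> 0"
  shows "beta_bound f F q L\<^sub>f L\<^sub>F \<alpha>bar c\<^sub>0 \<mu> \<rho>
    \<le> beta_bound f F q L\<^sub>f L\<^sub>F \<alpha>bar c\<^sub>0 \<mu> 1 * \<rho> powr (1 / q)"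
proof -
  have "\<mu> * L\<^sub>f * 1 \<le> \<mu> * L\<^sub>f * \<rho> powr (1 / q)"
    using assms by (intro mult_left_mono ge_one_powr_ge_zero) auto
  then show ?thesis
    by (simp add: beta_bound_def Let_def algebra_simps)
qed

lemma beta_bound_nonneg:
  assumes "\<mu> \<ge> 0" "L\<^sub>f \<ge> 0" "L\<^sub>F \<ge> 0" "q \<ge> 0"
  shows "0 \<le> beta_bound f F q L\<^sub>f L\<^sub>F \<alpha>bar c\<^sub>0 \<mu> \<rho>"
  using assms by (simp add: beta_bound_def Let_def)

lemma admissible_run_beta_le:
  assumes "admissible_run f F q S L\<^sub>f L\<^sub>F \<alpha>bar c\<^sub>0 \<rho>\<^sub>0 \<mu> \<rho> \<beta>low \<beta> x"
  shows "\<beta> (Suc k) \<le> beta_bound f F q L\<^sub>f L\<^sub>F \<alpha>bar c\<^sub>0 \<mu> \<rho>"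
  using assms cSUP_upper[of "Suc k" "{1..}" \<beta>] unfolding admissible_run_def by force

lemma penalty_initial_le:
  assumes "1 < q" "q \<le> 2" "assumption3 f F \<alpha>bar"
    and run: "admissible_run f F q S L\<^sub>f L\<^sub>F \<alpha>bar c\<^sub>0 \<rho>\<^sub>0 \<mu> \<rho> \<beta>low \<beta> x"
  shows "penalty f F q \<rho> (x 0) \<le> \<alpha>bar + c\<^sub>0"
proof -
  have "\<rho> \<ge> 1" and N: "qnorm q (F (x 0)) powr q \<le> 1" "qnorm q (F (x 0)) powr q \<le> q * c\<^sub>0 / \<rho>"
    using run by (auto simp: admissible_run_def)
  have "f (x 0) \<le> \<alpha>bar"
    using norm_le_1_of_qnorm_le_1[OF _ \<open>q \<le> 2\<close> N(1)] assms by (simp add: assumption3_def)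
  moreover have "\<rho> / q * qnorm q (F (x 0)) powr q \<le> \<rho> / q * (q * c\<^sub>0 / \<rho>)"
    using N(2) \<open>\<rho> \<ge> 1\<close> \<open>1 < q\<close> by (intro mult_left_mono) auto
  moreover have "\<rho> / q * (q * c\<^sub>0 / \<rho>) = c\<^sub>0"
    using \<open>\<rho> \<ge> 1\<close> \<open>1 < q\<close> by simp
  ultimately show ?thesis
    by (simp add: penalty_def)
qed

text \<open>The descent estimate is telescoped over the first \<open>N\<close> steps. The penalty
  starts at most at \<open>\<alpha>bar + c\<^sub>0\<close> and never falls below
  \<open>fbar\<close>.\<close>

lemma admissible_run_iteration_bound:
  assumes "1 < q" "q \<le> 2" "assumption3 f F \<alpha>bar" "\<And>y. fbar \<le> f y" "r > 0"
    and run: "admissible_run f F q S L\<^sub>f L\<^sub>F \<alpha>bar c\<^sub>0 \<rho>\<^sub>0 \<mu> \<rho> \<beta>low \<beta> x"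
    and Psi: "\<And>k. k < N \<Longrightarrow> Psi f F q \<rho> r (x k) > r\<^sup>2"
  shows "real N * r\<^sup>2 \<le> 2 * beta_bound f F q L\<^sub>f L\<^sub>F \<alpha>bar c\<^sub>0 \<mu> \<rho> * (\<alpha>bar + c\<^sub>0 - fbar)"
proof -
  define b where "b = beta_bound f F q L\<^sub>f L\<^sub>F \<alpha>bar c\<^sub>0 \<mu> \<rho>"
  have qLP: "qLP_sequence f F q \<rho> \<beta>low \<beta> x"
    using run by (simp add: admissible_run_def)
  have beta: "\<beta> (Suc k) \<ge> 1" for k
    by (rule qLP_sequence_beta_ge_1[OF qLP])
  have "\<rho> > 0"
    using qLP by (simp add: qLP_sequence_def)
  have le: "\<beta> (Suc k) \<le> b" for k
    using admissible_run_beta_le[OF run] by (simp add: b_def)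
  \<comment> \<open>The run itself shows this: an actual proximal parameter lies between 1 and
    \<open>b\<close>.\<close>
  have "b \<ge> 1"
    using beta[of 0] le[of 0] by linarith
  have "k \<le> N \<Longrightarrow> penalty f F q \<rho> (x k) + real k * (r\<^sup>2 / (2 * b)) \<le> penalty f F q \<rho> (x 0)" for k
  proof (induction k)
    case (Suc k)
    have "r\<^sup>2 / (2 * b) \<le> r\<^sup>2 / (2 * \<beta> (Suc k))"
      using le[of k] beta[of k] by (intro divide_left_mono) auto
    moreover have "real (Suc k) * (r\<^sup>2 / (2 * b)) = real k * (r\<^sup>2 / (2 * b)) + r\<^sup>2 / (2 * b)"
      by (simp only: of_nat_Suc distrib_right mult_1 add.commute)
    ultimately show ?case
      using qLP_sequence_descent[OF \<open>1 < q\<close> \<open>r > 0\<close> qLP Psi[of k]] Suc by linarith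
  qed simp
  from this[of N] have "penalty f F q \<rho> (x N) + real N * (r\<^sup>2 / (2 * b)) \<le> \<alpha>bar + c\<^sub>0"
    using penalty_initial_le[OF assms(1-3) run] by simp
  moreover have "fbar \<le> penalty f F q \<rho> (x N)"
    using assms(4)[of "x N"] \<open>\<rho> > 0\<close> \<open>1 < q\<close> by (simp add: penalty_def add_increasing2)
  ultimately have "real N * (r\<^sup>2 / (2 * b)) \<le> \<alpha>bar + c\<^sub>0 - fbar"
    by linarith
  then show ?thesis
    using \<open>b \<ge> 1\<close> by (simp add: field_simps flip: b_def)
qed

section \<open>Multiplier, feasibility and complexity combined\<close>

lemma Psi_multiplier_bound:
  assumes "q > 1" "\<rho> \<ge> 0" "0 < \<epsilon>" "Psi f F q \<rho> \<epsilon> x \<le> \<epsilon>\<^sup>2"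
  obtains u where "norm (grad f x + transpose (Jac F x) *v q_multiplier q \<rho> u) \<le> \<epsilon>"
    "norm (F x) \<le> norm u + spectral_norm (Jac F x) * \<epsilon>"
proof -
  obtain y where y: "norm (y - x) \<le> \<epsilon>"
    "\<epsilon> * norm (lin_penalty_grad f F q \<rho> y x) \<le> Psi f F q \<rho> \<epsilon> x"
    using Psi_minimizer_grad_bound[OF assms(1-3)] .
  have "\<epsilon> * norm (lin_penalty_grad f F q \<rho> y x) \<le> \<epsilon> * \<epsilon>"
    using y(2) assms(4) by (simp add: power2_eq_square)
  then have G: "norm (lin_penalty_grad f F q \<rho> y x) \<le> \<epsilon>"
    using \<open>0 < \<epsilon>\<close> by simp
  define u where "u = F x + Jac F x *v (y - x)"
  \<comment> \<open>The linearized residual \<open>u\<close> at the minimizer differs from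
    \<open>F x\<close> only by the Jacobian applied to a step of length at most
    \<open>\<epsilon>\<close>.\<close>
  have "norm (F x) \<le> norm u + norm (Jac F x *v (y - x))"
    using norm_triangle_ineq4[of u "Jac F x *v (y - x)"] by (simp add: u_def)
  also have "norm (Jac F x *v (y - x)) \<le> spectral_norm (Jac F x) * norm (y - x)"
    by (rule norm_mult_le_spectral_norm)
  also have "\<dots> \<le> spectral_norm (Jac F x) * \<epsilon>"
    using y(1) by (intro mult_left_mono) (auto simp: spectral_norm_def onorm_pos_le)
  finally have "norm (F x) \<le> norm u + spectral_norm (Jac F x) * \<epsilon>"
    by simp
  with G show ?thesis
    using that by (simp only: lin_penalty_grad_def u_def)
qed

theorem theorem4p2:
  fixes f :: "real^'n \<Rightarrow> real" and F :: "real^'n \<Rightarrow> real^'m" and S :: "(real^'n) set"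
    and q M\<^sub>f M\<^sub>F L\<^sub>f L\<^sub>F \<alpha>bar c\<^sub>0 \<rho>\<^sub>0 \<mu> :: real
  assumes "1 < q" and "q \<le> 2"
    and "C1 f" and "C1 F"
    and "{x. F x = 0} \<noteq> {}" and "bdd_below (f ` {x. F x = 0})"
    and "compact S"
    and "assumption1 f"
    and "assumption2 f F S M\<^sub>f M\<^sub>F L\<^sub>f L\<^sub>F"
    and "assumption3 f F \<alpha>bar"
    and "c\<^sub>0 > 0" and "\<rho>\<^sub>0 > 0" and "\<mu> > 1"
  shows "(\<forall>\<rho> \<beta>low \<beta> x \<epsilon> k.
            admissible_run f F q S L\<^sub>f L\<^sub>F \<alpha>bar c\<^sub>0 \<rho>\<^sub>0 \<mu> \<rho> \<beta>low \<beta> x \<longrightarrow>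
            0 < \<epsilon> \<longrightarrow> \<epsilon> \<le> 1 \<longrightarrow> Psi f F q \<rho> \<epsilon> (x k) \<le> \<epsilon>\<^sup>2 \<longrightarrow>
            (\<exists>lam. norm (grad f (x k) + transpose (Jac F (x k)) *v lam) \<le> \<epsilon>))
    \<and> (\<forall>c\<^sub>1 c\<^sub>2. 0 < c\<^sub>1 \<longrightarrow> c\<^sub>1 \<le> c\<^sub>2 \<longrightarrow>
         (\<exists>\<kappa> C. \<kappa> > 0 \<and> C > 0 \<and>
           (\<forall>\<rho> \<beta>low \<beta> x \<epsilon>.
              admissible_run f F q S L\<^sub>f L\<^sub>F \<alpha>bar c\<^sub>0 \<rho>\<^sub>0 \<mu> \<rho> \<beta>low \<beta> x \<longrightarrow>
              0 < \<epsilon> \<longrightarrow> \<epsilon> \<le> 1 \<longrightarrow>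
              c\<^sub>1 / \<epsilon> powr (q - 1) \<le> \<rho> \<longrightarrow> \<rho> \<le> c\<^sub>2 / \<epsilon> powr (q - 1) \<longrightarrow>
              (\<forall>k. Psi f F q \<rho> \<epsilon> (x k) \<le> \<epsilon>\<^sup>2 \<longrightarrow>
                 eps_first_order_solution f F \<epsilon> (x k) \<and>
                 (\<exists>lam. norm (grad f (x k) + transpose (Jac F (x k)) *v lam) \<le> \<epsilon> \<and>
                        norm (F (x k)) \<le> \<kappa> * \<epsilon>)) \<and>
              (\<exists>k. real k \<le> C * \<epsilon> powr - (2 + (q - 1) / q) \<and>
                   Psi f F q \<rho> \<epsilon> (x k) \<le> \<epsilon>\<^sup>2))))"
proof (intro conjI allI impI)
  fix \<rho> \<beta>low \<beta> x \<epsilon> k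
  assume run: "admissible_run f F q S L\<^sub>f L\<^sub>F \<alpha>bar c\<^sub>0 \<rho>\<^sub>0 \<mu> \<rho> \<beta>low \<beta> x"
    and \<epsilon>: "0 < \<epsilon>" and Psi: "Psi f F q \<rho> \<epsilon> (x k) \<le> \<epsilon>\<^sup>2"
  have "\<rho> \<ge> 0"
    using run by (auto simp: admissible_run_def)
  then show "\<exists>lam. norm (grad f (x k) + transpose (Jac F (x k)) *v lam) \<le> \<epsilon>"
    using Psi_multiplier_bound[OF \<open>1 < q\<close> _ \<epsilon> Psi] by blast
next
  fix c\<^sub>1 c\<^sub>2 :: real
  assume c: "0 < c\<^sub>1" "c\<^sub>1 \<le> c\<^sub>2"
  note A2 = \<open>assumption2 f F S M\<^sub>f M\<^sub>F L\<^sub>f L\<^sub>F\<close>[unfolded assumption2_def]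
  obtain \<sigma> where \<sigma>: "\<sigma> > 0"
    "\<And>y w. y \<in> S \<Longrightarrow> \<sigma> * norm w \<le> norm (transpose (Jac F y) *v w)"
    using uniform_LICQ[OF \<open>C1 F\<close> \<open>compact S\<close>] A2 by blast
  obtain fbar where fbar: "\<And>y. fbar \<le> f y"
    using bdd_below_of_assumption1[OF \<open>assumption1 f\<close> \<open>C1 f\<close>] by (auto simp: bdd_below_def)
  define p where "p = (q - 1) / q"
  \<comment> \<open>Since \<open>\<epsilon> \<le> 1\<close>, the transposed Jacobian maps the
    multiplier to a vector of norm at most \<open>1 + M\<^sub>f\<close>; dividing by
    \<open>\<sigma>\<close> bounds the multiplier. The summand \<open>M\<^sub>F\<close> pays for the
    linearization step.\<close>
  define \<kappa> where
    "\<kappa> = real CARD('m) * ((1 + M\<^sub>f) / \<sigma> / c\<^sub>1) powr (1 / (q - 1)) + M\<^sub>F"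
  \<comment> \<open>\<open>K\<close> is chosen so that the proximal parameters are at most
    \<open>K * \<epsilon> powr - p\<close>. In \<open>C\<close>, the absolute value avoids a sign
    discussion, and the summand 1 gives positivity and the strict inequality behind the final
    contradiction.\<close>
  define K where "K = beta_bound f F q L\<^sub>f L\<^sub>F \<alpha>bar c\<^sub>0 \<mu> 1 * c\<^sub>2 powr (1 / q)"
  define C where "C = 2 * K * \<bar>\<alpha>bar + c\<^sub>0 - fbar\<bar> + 1"
  have "K \<ge> 0"
    using A2 \<open>\<mu> > 1\<close> \<open>1 < q\<close> by (simp add: K_def beta_bound_nonneg)
  have "\<kappa> > 0"
    using A2 by (auto simp: \<kappa>_def intro!: add_nonneg_pos)
  have "C > 0"
    using \<open>K \<ge> 0\<close> by (auto simp: C_def intro!: add_nonneg_pos)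
  have feasible: "\<exists>lam. norm (grad f (x k) + transpose (Jac F (x k)) *v lam) \<le> \<epsilon> \<and>
      norm (F (x k)) \<le> \<kappa> * \<epsilon>"
    if run: "admissible_run f F q S L\<^sub>f L\<^sub>F \<alpha>bar c\<^sub>0 \<rho>\<^sub>0 \<mu> \<rho> \<beta>low \<beta> x"
      and \<epsilon>: "0 < \<epsilon>" "\<epsilon> \<le> 1" and \<rho>: "c\<^sub>1 / \<epsilon> powr (q - 1) \<le> \<rho>"
      and Psi: "Psi f F q \<rho> \<epsilon> (x k) \<le> \<epsilon>\<^sup>2" for \<rho> \<beta>low \<beta> x \<epsilon> k
  proof -
    have "\<rho> \<ge> 0" "x k \<in> S"
      using run by (auto simp: admissible_run_def)
    obtain u where u: "norm (grad f (x k) + transpose (Jac F (x k)) *v q_multiplier q \<rho> u) \<le> \<epsilon>"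
      "norm (F (x k)) \<le> norm u + spectral_norm (Jac F (x k)) * \<epsilon>"
      using Psi_multiplier_bound[OF \<open>1 < q\<close> \<open>\<rho> \<ge> 0\<close> \<epsilon>(1) Psi] .
    have "\<sigma> * norm (q_multiplier q \<rho> u)
        \<le> norm (transpose (Jac F (x k)) *v q_multiplier q \<rho> u)"
      by (rule \<sigma>(2)[OF \<open>x k \<in> S\<close>])
    also have "\<dots> \<le> norm (grad f (x k) + transpose (Jac F (x k)) *v q_multiplier q \<rho> u)
        + norm (grad f (x k))"
      using norm_triangle_ineq4[of
          "grad f (x k) + transpose (Jac F (x k)) *v q_multiplier q \<rho> u" "grad f (x k)"]
      by simp
    also have "\<dots> \<le> 1 + M\<^sub>f"
      using u(1) \<epsilon>(2) A2 \<open>x k \<in> S\<close> by (intro add_mono) auto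
    finally have "norm (q_multiplier q \<rho> u) \<le> (1 + M\<^sub>f) / \<sigma>"
      using \<open>\<sigma> > 0\<close> by (simp add: field_simps)
    then have "norm u \<le> real CARD('m) * ((1 + M\<^sub>f) / \<sigma> / c\<^sub>1) powr (1 / (q - 1)) * \<epsilon>"
      by (rule norm_le_of_q_multiplier_bound[OF \<open>1 < q\<close> c(1) \<epsilon>(1) \<rho>])
    moreover have "spectral_norm (Jac F (x k)) * \<epsilon> \<le> M\<^sub>F * \<epsilon>"
      using A2 \<open>x k \<in> S\<close> \<epsilon>(1) by (intro mult_right_mono) auto
    ultimately have "norm (F (x k)) \<le> \<kappa> * \<epsilon>"
      using u(2) by (simp add: \<kappa>_def distrib_right)
    with u(1) show ?thesis
      by blast
  qed
  have iterations: "\<exists>k. real k \<le> C * \<epsilon> powr - (2 + p) \<and> Psi f F q \<rho> \<epsilon> (x k) \<le> \<epsilon>\<^sup>2"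
    if run: "admissible_run f F q S L\<^sub>f L\<^sub>F \<alpha>bar c\<^sub>0 \<rho>\<^sub>0 \<mu> \<rho> \<beta>low \<beta> x"
      and \<epsilon>: "0 < \<epsilon>" and \<rho>: "\<rho> \<le> c\<^sub>2 / \<epsilon> powr (q - 1)" for \<rho> \<beta>low \<beta> x \<epsilon>
  proof (rule ccontr)
    assume contra: "\<not> ?thesis"
    have "\<rho> \<ge> 1"
      using run by (auto simp: admissible_run_def)
    define b where "b = beta_bound f F q L\<^sub>f L\<^sub>F \<alpha>bar c\<^sub>0 \<mu> \<rho>"
    \<comment> \<open>Every index below \<open>N\<close> respects the claimed bound, so its
      \<open>Psi\<close> is too large, whereas \<open>N\<close> itself exceeds that bound.\<close>
    define N where "N = Suc (nat \<lfloor>C * \<epsilon> powr - (2 + p)\<rfloor>)"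
    have "\<not> real k \<le> C * \<epsilon> powr - (2 + p) \<or> Psi f F q \<rho> \<epsilon> (x k) > \<epsilon>\<^sup>2" for k
      using contra not_le by blast
    moreover have "real k \<le> C * \<epsilon> powr - (2 + p)" if "k < N" for k
      using that \<open>C > 0\<close> by (simp add: N_def less_Suc_eq_le le_nat_iff le_floor_iff)
    ultimately have "real N * \<epsilon>\<^sup>2 \<le> 2 * b * (\<alpha>bar + c\<^sub>0 - fbar)"
      unfolding b_def
      by (intro admissible_run_iteration_bound[OF \<open>1 < q\<close> \<open>q \<le> 2\<close> \<open>assumption3 f F \<alpha>bar\<close> fbar \<epsilon> run])
        blast
    also have "\<dots> \<le> 2 * b * \<bar>\<alpha>bar + c\<^sub>0 - fbar\<bar>"
      using A2 \<open>\<mu> > 1\<close> \<open>1 < q\<close> by (intro mult_left_mono) (auto simp: b_def beta_bound_nonneg)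
    also have "\<dots> \<le> 2 * (K * \<epsilon> powr - p) * \<bar>\<alpha>bar + c\<^sub>0 - fbar\<bar>"
    proof -
      have "\<rho> powr (1 / q) \<le> (c\<^sub>2 / \<epsilon> powr (q - 1)) powr (1 / q)"
        using \<rho> \<open>\<rho> \<ge> 1\<close> \<open>1 < q\<close> by (intro powr_mono2) auto
      also have "\<dots> = c\<^sub>2 powr (1 / q) * \<epsilon> powr - p"
        using c by (simp add: powr_divide powr_powr powr_minus_divide p_def)
      finally have *: "\<rho> powr (1 / q) \<le> c\<^sub>2 powr (1 / q) * \<epsilon> powr - p" .
      have "b \<le> beta_bound f F q L\<^sub>f L\<^sub>F \<alpha>bar c\<^sub>0 \<mu> 1 * \<rho> powr (1 / q)"
        unfolding b_def using A2 \<open>\<mu> > 1\<close> \<open>1 < q\<close> \<open>\<rho> \<ge> 1\<close> by (intro beta_bound_le) auto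
      also have "\<dots> \<le> beta_bound f F q L\<^sub>f L\<^sub>F \<alpha>bar c\<^sub>0 \<mu> 1 * (c\<^sub>2 powr (1 / q) * \<epsilon> powr - p)"
        using A2 \<open>\<mu> > 1\<close> \<open>1 < q\<close> by (intro mult_left_mono[OF *] beta_bound_nonneg) auto
      finally show ?thesis
        by (intro mult_right_mono) (auto simp: K_def mult.assoc)
    qed
    also have "\<dots> < C * \<epsilon> powr - p"
      using \<epsilon> by (simp add: C_def algebra_simps)
    \<comment> \<open>Splitting off \<open>\<epsilon>\<^sup>2\<close> matches the form of the
      decrease over \<open>N\<close> steps.\<close>
    also have "\<dots> = C * \<epsilon> powr - (2 + p) * \<epsilon>\<^sup>2"
      using \<epsilon> by (simp add: powr_add[symmetric] flip: powr_numeral)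
    also have "\<dots> \<le> real N * \<epsilon>\<^sup>2"
      unfolding N_def by (intro mult_right_mono) (linarith, simp)
    finally show False
      by simp
  qed
  show "\<exists>\<kappa> C. \<kappa> > 0 \<and> C > 0 \<and>
    (\<forall>\<rho> \<beta>low \<beta> x \<epsilon>.
       admissible_run f F q S L\<^sub>f L\<^sub>F \<alpha>bar c\<^sub>0 \<rho>\<^sub>0 \<mu> \<rho> \<beta>low \<beta> x \<longrightarrow>
       0 < \<epsilon> \<longrightarrow> \<epsilon> \<le> 1 \<longrightarrow>
       c\<^sub>1 / \<epsilon> powr (q - 1) \<le> \<rho> \<longrightarrow> \<rho> \<le> c\<^sub>2 / \<epsilon> powr (q - 1) \<longrightarrow>
       (\<forall>k. Psi f F q \<rho> \<epsilon> (x k) \<le> \<epsilon>\<^sup>2 \<longrightarrow>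
          eps_first_order_solution f F \<epsilon> (x k) \<and>
          (\<exists>lam. norm (grad f (x k) + transpose (Jac F (x k)) *v lam) \<le> \<epsilon> \<and>
                 norm (F (x k)) \<le> \<kappa> * \<epsilon>)) \<and>
       (\<exists>k. real k \<le> C * \<epsilon> powr - (2 + (q - 1) / q) \<and> Psi f F q \<rho> \<epsilon> (x k) \<le> \<epsilon>\<^sup>2))"
  proof (rule exI[of _ \<kappa>], rule exI[of _ C], intro conjI allI impI)
    show "\<kappa> > 0" "C > 0"
      by fact+
  next
    fix \<rho> \<beta>low \<beta> x \<epsilon> k
    assume *: "admissible_run f F q S L\<^sub>f L\<^sub>F \<alpha>bar c\<^sub>0 \<rho>\<^sub>0 \<mu> \<rho> \<beta>low \<beta> x" "0 < \<epsilon>" "\<epsilon> \<le> 1"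
      "c\<^sub>1 / \<epsilon> powr (q - 1) \<le> \<rho>" "Psi f F q \<rho> \<epsilon> (x k) \<le> \<epsilon>\<^sup>2"
    show "\<exists>lam. norm (grad f (x k) + transpose (Jac F (x k)) *v lam) \<le> \<epsilon> \<and>
        norm (F (x k)) \<le> \<kappa> * \<epsilon>"
      by (rule feasible[OF *])
    \<comment> \<open>The witnesses are \<open>\<kappa>\<^sub>1 = 1\<close> and
      \<open>\<kappa>\<^sub>2 = \<kappa>\<close>.\<close>
    then show "eps_first_order_solution f F \<epsilon> (x k)"
      unfolding eps_first_order_solution_def using \<open>\<kappa> > 0\<close>
      by (metis mult_1 zero_less_one)
  qed (use iterations in \<open>simp only: p_def\<close>)
qed

end
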